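(* Let $X_n$ be the number of correct guesses in the no-feedback card guessing game after a single Gilbert–Shannon–Reeds riffle shuffle of an ordered deck of $n$ cards, when the guesser follows the strategy $\mathcal{G}^{\ast}$ described in the context. Then for every fixed integer $s\ge 0$, as $n\to\infty$, \[ \mathbb{E}\Big(\Big(\frac{X_n}{\sqrt{n}}\Big)^s\Big)\to \tilde{\mu}_s=\mathbb{E}\big((H_1+H_2)^s\big)=\sum_{k=0}^{s}\binom{s}{k}\frac{\Gamma\big(\frac{k+1}{2}\big)\Gamma\big(\frac{s-k+1}{2}\big)}{\pi}, \] where $H_1,H_2$ are independent half-normal random variables, each with density $\frac{2}{\sqrt{\pi}}e^{-x^2}$ for $x\ge 0$.
   Context: Riffle shuffle (Gilbert–Shannon–Reeds model): a deck of $n$ cards labeled $1,\dots,n$ from top to bottom is cut at position $k$ (the first packet consists of cards $1,\dots,k$, the second of cards $k+1,\dots,n$) with probability $\binom{n}{k}/2^n$, $0\le k\le n$. Given the cut, the two packets are interleaved, each of the $\binom{n}{k}$ interleavings preserving the relative order within each packet being equally likely (equivalently, while $m_1$ and $m_2$ cards remain in the packets, the next card comes from the first packet with probability $m_1/(m_1+m_2)$). Let $\sigma(j)$ be the label of the card at position $j$ (from the top) of the resulting deck. No-feedback game: the guesser makes a guess $g_j$ for each position $j$ without any information. The strategy $\mathcal{G}^{\ast}=(g_1,\dots,g_n)$ guesses the top half with $1,2,2,3,3,4,4,\dots$ and the bottom half with $\dots,n-2,n-2,n-1,n-1,n$; precisely, with $h=\lceil n/2\rceil$, $g_j=\lfloor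 j/2\rfloor+1$ for $1\le j\le h$ and $g_j=n-\lfloor (n-j+1)/2\rfloor$ for $h<j\le n$. Then $X_n=\#\{j:\sigma(j)=g_j\}$. *)

theory Defs
  imports "HOL-Probability.Probability"
begin

text \<open>A deck is the list of its card labels from top to bottom, so position \<open>j\<close> (counted from 1)
  holds the card \<open>d ! (j - 1)\<close>.\<close>

definition gsr_shuffle :: "nat \<Rightarrow> nat list pmf" where
  "gsr_shuffle n =
     bind_pmf (binomial_pmf n (1 / 2))
       (\<lambda>k. pmf_of_set (shuffles [1..<k + 1] [k + 1..<n + 1]))"

definition guess :: "nat \<Rightarrow> nat \<Rightarrow> nat" where
  "guess n j =
     (if j \<le> nat \<lceil>real n / 2\<rceil> then j div 2 + 1 else n - (n - j + 1) div 2)"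

definition correct_guesses :: "nat \<Rightarrow> nat list \<Rightarrow> nat" where
  "correct_guesses n d = card {j \<in> {1..n}. d ! (j - 1) = guess n j}"

definition half_normal_density :: "real \<Rightarrow> real" where
  "half_normal_density x = (if x < 0 then 0 else 2 / sqrt pi * exp (- (x\<^sup>2)))"

end

theory Submission
  imports Defs "HOL-Real_Asymp.Real_Asymp"
begin

text \<open>
  A riffle shuffle is encoded by \<open>n\<close> fair bits telling which packet each position comes from. Among the
  top positions a card of the second packet can match its guess only at positions 1 and 2, while a
  card of the first packet matches iff the simple random walk driven by the bits makes an up-step
  from level 0 or 1. The bottom half is the mirror image, so up to an error of at most 4 the number
  of correct guesses is a sum of two independent copies of this hit count.

  The hit count lies stochastically between the number of returns to the origin of a simple random
  walk and that number plus one. If \<open>N\<close> is the number of returns within \<open>2 m\<close> steps, then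
  \<open>E[(N + 1) \<dots> (N + r)] = r! (r / 2 + 1) \<dots> (r / 2 + m) / m!\<close>, which is proved by creative
  telescoping and yields all moments asymptotically through Euler's limit for the Gamma function.
\<close>

section \<open>Returns of the simple random walk\<close>

text \<open>\<open>reach n j\<close> is the probability that the maximum of an \<open>n\<close>-step simple random walk is at least \<open>j\<close>.\<close>

fun reach :: "nat \<Rightarrow> nat \<Rightarrow> real" where
  "reach n 0 = 1"
| "reach 0 (Suc j) = 0"
| "reach (Suc n) (Suc j) = (reach n j + reach n (Suc (Suc j))) / 2"

lemma reach_nonneg: "0 \<le> reach n j"
  by (induction n j rule: reach.induct) auto

lemma reach_le_1: "reach n j \<le> 1"
  by (induction n j rule: reach.induct) auto

lemma reach_eq_0: "n < j \<Longrightarrow> reach n j = 0"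
  by (induction n j rule: reach.induct) auto

lemma reach_mono_Suc: "reach n j \<le> reach (Suc n) j"
proof (induction n j rule: reach.induct)
  case (2 j)
  then show ?case using reach_nonneg[of "Suc 0" "Suc j"] by simp
next
  case (3 n j)
  then show ?case unfolding reach.simps(3)[of n j] reach.simps(3)[of "Suc n" j]
    by (intro divide_right_mono add_mono) simp_all
qed simp

lemma reach_mono: "m \<le> n \<Longrightarrow> reach m j \<le> reach n j"
  by (rule lift_Suc_mono_le[of "\<lambda>n. reach n j"]) (rule reach_mono_Suc)

text \<open>Reflection principle: the maximum equals \<open>j\<close> exactly as often as the walk
  ends at \<open>j\<close> or \<open>j + 1\<close>. Parity admits only one of these endpoints, and
  it takes \<open>(n + j + 1) div 2\<close> up-steps. The induction conditions on the first step and
  applies Pascal's rule.\<close>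

lemma reach_diff:
  "reach n j - reach n (Suc j) = real (n choose ((n + j + 1) div 2)) / 2 ^ n"
proof (induction n arbitrary: j)
  case 0
  then show ?case by (cases j) auto
next
  case (Suc n)
  show ?case
  proof (cases j)
    case [simp]: 0
    have "1 - reach (Suc n) (Suc 0)
        = ((reach n 0 - reach n 1) + (reach n 1 - reach n 2)) / 2"
      by (simp add: numeral_2_eq_2 field_simps)
    also have "\<dots> = real ((n choose ((n+1) div 2)) + (n choose ((n+2) div 2))) / 2 ^ Suc n"
      using Suc[of 0] Suc[of 1] by (simp add: numeral_2_eq_2 field_simps)
    \<comment> \<open>For odd \<open>n\<close> this passes from the upper to the lower of the two
      equal central coefficients, so that the two terms become neighbours.\<close>
    also have "n choose ((n+1) div 2) = n choose (n div 2)"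
    proof (cases "even n")
      case False
      then obtain q where q: "n = 2 * q + 1" by (rule oddE)
      then show ?thesis using binomial_symmetric[of q n] by simp
    qed auto
    also have "(n choose (n div 2)) + (n choose ((n+2) div 2)) = Suc n choose Suc (n div 2)"
      by simp
    finally show ?thesis by simp
  next
    case [simp]: (Suc i)
    have "reach (Suc n) (Suc i) - reach (Suc n) (Suc (Suc i))
        = ((reach n i - reach n (Suc i)) + (reach n (Suc (Suc i)) - reach n (Suc (Suc (Suc i))))) / 2"
      by (simp add: field_simps)
    also have "\<dots> = real ((n choose ((n+i+1) div 2)) + (n choose ((n+i+3) div 2))) / 2 ^ Suc n"
      unfolding Suc.IH by (simp add: field_simps numeral_3_eq_3)
    also have "(n choose ((n+i+1) div 2)) + (n choose ((n+i+3) div 2)) = Suc n choose ((Suc n + j + 1) div 2)"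
    proof -
      have "(n+i+3) div 2 = Suc ((n+i+1) div 2)" by simp
      moreover have "(Suc n + j + 1) div 2 = Suc ((n+i+1) div 2)" by simp
      ultimately show ?thesis by (simp only: binomial_Suc_Suc)
    qed
    finally show ?thesis by simp
  qed
qed

lemma reach_antimono_Suc: "reach n (Suc j) \<le> reach n j"
  using reach_diff[of n j] by (smt (verit) divide_nonneg_nonneg of_nat_0_le_iff zero_le_power)

section \<open>The law of the number of returns to the origin\<close>

text \<open>\<open>ret_mass n\<close> is the law of the number of returns to the origin within \<open>2 * n\<close> steps.\<close>

definition ret_mass :: "nat \<Rightarrow> nat \<Rightarrow> real" where
  "ret_mass n k = 2 ^ k * real ((2 * n - k) choose n) / 4 ^ n"

definition ret_mean :: "nat \<Rightarrow> (nat \<Rightarrow> real) \<Rightarrow> real" where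
  "ret_mean n f = (\<Sum>k\<le>n. f k * ret_mass n k)"

text \<open>The \<open>k\<close>-th return time has the law of \<open>k\<close> plus the first
  passage time to level \<open>k\<close>, so \<open>reach (2 * n - k) k\<close> is the probability
  of at least \<open>k\<close> returns. The right-hand side is thus a difference of consecutive
  tails.\<close>

lemma ret_mass_eq_reach_diff:
  assumes "k \<le> n"
  shows "ret_mass n k = reach (2 * n - k) k - reach (2 * n - Suc k) (Suc k)"
proof (cases "n = 0")
  case True
  then show ?thesis using assms by (simp add: ret_mass_def)
next
  case False
  then have "0 < 2 * n - k" using assms by simp
  then obtain N where N: "2 * n - k = Suc N" using gr0_implies_Suc by blast
  have N': "2 * n - Suc k = N" using N by simp
  have p4: "(4::real) ^ n = 2 ^ k * 2 ^ Suc N"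
  proof -
    have "(4::real) ^ n = 2 ^ (2 * n)" by (simp add: power_mult)
    also have "2 * n = k + Suc N" using N assms by simp
    finally show ?thesis by (simp add: power_add)
  qed
  show ?thesis
  proof (cases k)
    case [simp]: 0
    obtain q where q: "n = Suc q" using False by (cases n) auto
    have "N = 2 * q + 1" using N q by simp
    then have "N choose q = N choose Suc q" using binomial_symmetric[of q N] by simp
    then have "(2 * n choose n) = 2 * (N choose n)" using N q by simp
    moreover have "(N + 1) div 2 = n" using N by simp
    ultimately show ?thesis
      using reach_diff[of N 0] p4 N' by (simp add: ret_mass_def)
  next
    case [simp]: (Suc i)
    \<comment> \<open>Inserting the intermediate tail \<open>reach N (Suc i)\<close> yields two
      instances of \<open>reach_diff\<close> that Pascal's rule merges.\<close>
    have "reach (Suc N) (Suc i) - reach N (Suc (Suc i))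
       = ((reach N i - reach N (Suc i)) + (reach N (Suc i) - reach N (Suc (Suc i)))) / 2"
      by (simp add: field_simps)
    also have "\<dots> = real ((N choose ((N+i+1) div 2)) + (N choose ((N+i+2) div 2))) / 2 ^ Suc N"
      unfolding reach_diff by (simp add: field_simps)
    also obtain q where q: "n = Suc q" using False by (cases n) auto
    have *: "N + i + 1 = 2 * q + 1" "N + i + 2 = 2 * q + 2" using N q assms by auto
    have "(N + i + 1) div 2 = q" "(N + i + 2) div 2 = Suc q" unfolding * by simp_all
    then have "(N choose ((N+i+1) div 2)) + (N choose ((N+i+2) div 2)) = Suc N choose n"
      using q by (simp only: binomial_Suc_Suc)
    finally show ?thesis unfolding ret_mass_def N' N p4 by simp
  qed
qed

text \<open>Summation by parts. Tails beyond \<open>n\<close> vanish, so any cutoff \<open>N\<close>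
  from \<open>n\<close> on is allowed; this permits a termwise comparison with the tail sums of hit
  counts.\<close>

lemma ret_mean_eq_tail_sum:
  assumes "n \<le> N"
  shows "ret_mean n f = f 0 + (\<Sum>k<N. (f (Suc k) - f k) * reach (2 * n - Suc k) (Suc k))"
proof -
  have *: "(\<Sum>k<m. f k * (t k - t (Suc k))) = f 0 * t 0 - f m * t m + (\<Sum>k<m. (f (Suc k) - f k) * t (Suc k))"
    for m and t :: "nat \<Rightarrow> real"
    by (induction m) (simp_all add: algebra_simps)
  let ?t = "\<lambda>k. reach (2 * n - k) k"
  have z: "?t k = 0" if "k > n" for k using that by (intro reach_eq_0) linarith
  have "ret_mean n f = (\<Sum>k<Suc n. f k * (?t k - ?t (Suc k)))"
    unfolding ret_mean_def lessThan_Suc_atMost by (intro sum.cong) (auto simp: ret_mass_eq_reach_diff)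
  also have "\<dots> = (\<Sum>k<Suc N. f k * (?t k - ?t (Suc k)))"
    using assms z by (intro sum.mono_neutral_left) auto
  also have "\<dots> = f 0 + (\<Sum>k<Suc N. (f (Suc k) - f k) * ?t (Suc k))"
    using *[of ?t "Suc N"] z[of "Suc N"] assms by (simp only: reach.simps)
  also have "\<dots> = f 0 + (\<Sum>k<N. (f (Suc k) - f k) * ?t (Suc k))"
    using z[of "Suc N"] assms by simp
  finally show ?thesis .
qed

section \<open>Rising factorial moments of the number of returns\<close>

text \<open>The contiguity relation behind the telescoping certificate below. After substituting
  \<open>k = n + 1 - j\<close> it is a combination of the two absorption identities
  \<open>b1\<close> and \<open>b2\<close>.\<close>

lemma binomial_ret_mass_recurrence:
  assumes "k \<le> n + 1"
  shows "real (n + 1) * real ((2 * n + 2 - k) choose (n + 1)) =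
    (4 * real n + 2 - 2 * real k) * real ((2 * n - k) choose n) +
      real k * real ((2 * n + 1 - k) choose n)"
proof -
  define j where "j = n + 1 - k"
  have k: "n + 1 = k + j" and e: "2 * n + 2 - k = Suc (n + j)" "2 * n + 1 - k = n + j" "2 * n - k = n + j - 1"
    using assms unfolding j_def by auto
  have b2: "(n + 1) * (Suc (n + j) choose (n + 1)) = (n + 1 + j) * (n + j choose n)"
    using Suc_times_binomial[of n "n + j"] by simp
  have b1: "j * (n + j choose n) = (n + j) * (n + j - 1 choose n)"
  proof (cases j)
    case (Suc i)
    then show ?thesis
      using Suc_times_binomial_add[of n i] binomial_absorb_comp[of "n + j" n] by simp
  qed (cases n; simp)
  have b2': "real (n + 1) * real (Suc (n + j) choose (n + 1)) = real (n + 1 + j) * real (n + j choose n)"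
    using b2 by (metis of_nat_mult)
  have b1': "real j * real (n + j choose n) = real (n + j) * real (n + j - 1 choose n)"
    using b1 by (metis of_nat_mult)
  have k': "real k = real n + 1 - real j" using k by linarith
  show ?thesis unfolding e b2' k' using b1' by (simp add: algebra_simps)
qed

text \<open>Creative telescoping: the summands of the two sides differ by
  \<open>G (Suc k) - G k\<close>, and \<open>G\<close> vanishes at both ends of the range.\<close>

lemma ret_mean_pochhammer_Suc:
  "(real n + 1) * ret_mean (Suc n) (\<lambda>k. pochhammer (real k + 1) r)
     = (real n + 1 + real r / 2) * ret_mean n (\<lambda>k. pochhammer (real k + 1) r)"
proof -
  let ?c = "\<lambda>k. pochhammer (real k + 1) r"
  \<comment> \<open>Zeilberger certificate.\<close>
  define G where "G k = - (real k * ?c k * 2 ^ k * real ((2 * n + 1 - k) choose n) / 4 ^ Suc n)" for k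
  have c: "(real k + 1) * ?c (Suc k) = (real k + 1 + real r) * ?c k" for k
    using pochhammer_rec[of "real k + 1" r] pochhammer_rec'[of "real k + 1" r]
    by (simp add: add.commute add.left_commute)
  show ?thesis
  \<comment> \<open>For positive \<open>n\<close> the summand at \<open>k = n + 1\<close> and the
    value \<open>G (n + 2)\<close> contain the factor \<open>(n - 1) choose n = 0\<close>. For
    \<open>n = 0\<close> truncated subtraction makes this factor \<open>0 choose 0 = 1\<close>, so
    that case is checked by hand.\<close>
  proof (cases "n = 0")
    case True
    then show ?thesis using c[of 0] by (simp add: ret_mean_def ret_mass_def field_simps)
  next
    case False
    have step: "(real n + 1) * (?c k * ret_mass (Suc n) k) - (real n + 1 + real r / 2) * (?c k * (2 ^ k * real ((2 * n - k) choose n) / 4 ^ n))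
        = G (Suc k) - G k" if "k \<le> n + 1" for k
    proof -
      let ?b0 = "real ((2 * n - k) choose n)" and ?b1 = "real ((2 * n + 1 - k) choose n)"
        and ?b2 = "real ((2 * n + 2 - k) choose (n + 1))"
      have "G (Suc k) = - (((real k + 1) * ?c (Suc k)) * 2 ^ Suc k * ?b0 / 4 ^ Suc n)"
        by (simp add: G_def add.commute)
      also have "\<dots> = - ((real k + 1 + real r) * ?c k * 2 ^ Suc k * ?b0 / 4 ^ Suc n)"
        unfolding c ..
      finally have "G (Suc k) - G k = ?c k * 2 ^ k / 4 ^ Suc n * (real k * ?b1 - 2 * (real k + 1 + real r) * ?b0)"
        by (simp add: G_def field_simps)
      also have "real k * ?b1 - 2 * (real k + 1 + real r) * ?b0
         = real (n + 1) * ?b2 - 4 * (real n + 1 + real r / 2) * ?b0"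
        unfolding binomial_ret_mass_recurrence[OF that] by (simp add: algebra_simps)
      finally have G: "G (Suc k) - G k = ?c k * 2 ^ k / 4 ^ Suc n *
        (real (n + 1) * ?b2 - 4 * (real n + 1 + real r / 2) * ?b0)" .
      show ?thesis
        unfolding G ret_mass_def by (simp add: field_simps)
    qed
    have s: "ret_mean n ?c = (\<Sum>k\<le>Suc n. ?c k * (2 ^ k * real ((2 * n - k) choose n) / 4 ^ n))"
      using False by (simp add: ret_mean_def ret_mass_def)
    have "(real n + 1) * ret_mean (Suc n) ?c - (real n + 1 + real r / 2) * ret_mean n ?c
        = (\<Sum>k\<le>Suc n. G (Suc k) - G k)"
      unfolding s unfolding ret_mean_def sum_distrib_left sum_subtractf[symmetric]
      by (intro sum.cong refl step) simp
    also have "\<dots> = G (Suc (Suc n)) - G 0"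
      using sum_lessThan_telescope[of G "Suc (Suc n)"] by (simp add: lessThan_Suc_atMost)
    also have "\<dots> = 0" using False by (simp add: G_def)
    finally show ?thesis by simp
  qed
qed

lemma ret_mean_pochhammer:
  "ret_mean n (\<lambda>k. pochhammer (real k + 1) r) = fact r * pochhammer (real r / 2 + 1) n / fact n"
proof (induction n)
  case 0
  then show ?case by (simp add: ret_mean_def ret_mass_def pochhammer_fact)
next
  case (Suc n)
  have "(real n + 1) * ret_mean (Suc n) (\<lambda>k. pochhammer (real k + 1) r)
    = (real n + 1 + real r / 2) * (fact r * pochhammer (real r / 2 + 1) n / fact n)"
    unfolding ret_mean_pochhammer_Suc Suc ..
  then show ?case by (simp add: divide_simps pochhammer_rec') (simp add: algebra_simps)
qed

section \<open>Hits of a fair bit sequence\<close>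

definition bit_mean :: "nat \<Rightarrow> (bool list \<Rightarrow> real) \<Rightarrow> real" where
  "bit_mean m f = (\<Sum>bs | length bs = m. f bs) / 2 ^ m"

lemma finite_bit_lists: "finite {bs :: bool list. length bs = m}"
  using finite_lists_length_eq[of "UNIV :: bool set" m] by simp

lemma card_bit_lists: "card {bs :: bool list. length bs = m} = 2 ^ m"
  using card_lists_length_eq[of "UNIV :: bool set" m] by simp

lemma bit_mean_append: "bit_mean (m + l) f = bit_mean m (\<lambda>u. bit_mean l (\<lambda>v. f (u @ v)))"
proof -
  have "(\<Sum>bs | length bs = m + l. f bs)
      = (\<Sum>(u, v)\<in>{u. length u = m} \<times> {v. length v = l}. f (u @ v))"
    by (rule sum.reindex_bij_witness[of _ "\<lambda>(u, v). u @ v" "\<lambda>bs. (take m bs, drop m bs)"]) auto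
  also have "\<dots> = (\<Sum>u | length u = m. \<Sum>v | length v = l. f (u @ v))"
    by (simp add: sum.cartesian_product)
  finally show ?thesis
    by (simp add: bit_mean_def sum_divide_distrib[symmetric] power_add mult.commute)
qed

lemma bit_mean_Suc:
  "bit_mean (Suc m) f = (bit_mean m (\<lambda>bs. f (True # bs)) + bit_mean m (\<lambda>bs. f (False # bs))) / 2"
proof -
  have "{bs :: bool list. length bs = 1} = {[True], [False]}"
    by (auto simp: length_Suc_conv)
  then have "bit_mean 1 g = (g [True] + g [False]) / 2" for g
    by (simp add: bit_mean_def)
  with bit_mean_append[of 1 m f] show ?thesis by simp
qed

text \<open>Reversing and complementing is an involution on bit strings. It will turn the bottom
  half of the deck into a copy of the top half.\<close>

lemma bit_mean_rev_Not: "bit_mean m (\<lambda>bs. f (rev (map Not bs))) = bit_mean m f"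
  unfolding bit_mean_def
  by (intro arg_cong[of _ _ "\<lambda>x. x / _"]
      sum.reindex_bij_witness[of _ "\<lambda>bs. rev (map Not bs)" "\<lambda>bs. rev (map Not bs)"])
    (auto simp: rev_map comp_def)

lemma bit_mean_cong: "(\<And>bs. length bs = m \<Longrightarrow> f bs = g bs) \<Longrightarrow> bit_mean m f = bit_mean m g"
  unfolding bit_mean_def by (intro arg_cong[of _ _ "\<lambda>x. x / _"] sum.cong) auto

lemma bit_mean_mono: "(\<And>bs. length bs = m \<Longrightarrow> f bs \<le> g bs) \<Longrightarrow> bit_mean m f \<le> bit_mean m g"
  unfolding bit_mean_def by (intro divide_right_mono sum_mono) auto

lemma bit_mean_add: "bit_mean m (\<lambda>bs. f bs + g bs) = bit_mean m f + bit_mean m g"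
  by (simp add: bit_mean_def sum.distrib add_divide_distrib)

lemma bit_mean_sum: "bit_mean m (\<lambda>bs. \<Sum>i\<in>I. f i bs) = (\<Sum>i\<in>I. bit_mean m (f i))"
  unfolding bit_mean_def sum_divide_distrib[symmetric] by (subst sum.swap) simp

lemma bit_mean_cmult: "bit_mean m (\<lambda>bs. c * f bs) = c * bit_mean m f"
  by (simp add: bit_mean_def sum_distrib_left[symmetric])

lemma bit_mean_const [simp]: "bit_mean m (\<lambda>_. c) = c"
  by (simp add: bit_mean_def card_bit_lists)

section \<open>Hit counts and their tails\<close>

text \<open>The number of up-steps from level \<open>0\<close> or \<open>1\<close> of the walk that starts at \<open>w\<close> and has up-steps \<open>True\<close>.\<close>

fun hits :: "int \<Rightarrow> bool list \<Rightarrow> nat" where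
  "hits w [] = 0"
| "hits w (b # bs) = of_bool (b \<and> w \<in> {0, 1}) + hits (if b then w + 1 else w - 1) bs"

lemma hits_le_length: "hits w bs \<le> length bs"
  by (induction w bs rule: hits.induct) auto

definition hit_tail :: "int \<Rightarrow> nat \<Rightarrow> nat \<Rightarrow> real" where
  "hit_tail w m k = bit_mean m (\<lambda>bs. of_bool (k \<le> hits w bs))"

lemma hit_tail_0 [simp]: "hit_tail w m 0 = 1"
  by (simp add: hit_tail_def)

lemma hit_tail_eq_0: "m < k \<Longrightarrow> hit_tail w m k = 0"
proof -
  assume "m < k"
  then have "\<not> k \<le> hits w bs" if "length bs = m" for bs
    using hits_le_length[of w bs] that by simp
  then have "hit_tail w m k = bit_mean m (\<lambda>_. 0)"
    unfolding hit_tail_def by (intro bit_mean_cong) simp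
  then show ?thesis by simp
qed

text \<open>First-step analysis. The truncated \<open>k - 1\<close> is harmless at
  \<open>k = 0\<close>, where the tail is 1 anyway.\<close>

lemma hit_tail_Suc:
  "hit_tail w (Suc m) k =
    (hit_tail (w + 1) m (if w \<in> {0, 1} then k - 1 else k) + hit_tail (w - 1) m k) / 2"
  by (simp add: hit_tail_def bit_mean_Suc le_diff_conv)

text \<open>From level \<open>1\<close>, the waiting time for \<open>k \<ge> 1\<close> hits is distributed as \<open>k\<close> plus the first passage
  time to a level drawn uniformly from \<open>{k - 1, k}\<close>; other starting levels add a passage to \<open>1\<close>.\<close>

lemma hit_tail_reach:
  shows hit_tail_reach_above: "m = n + Suc k \<Longrightarrow>
      hit_tail (1 + int i) m (Suc k) = (reach n (i + k) + reach n (i + Suc k)) / 2"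
    and hit_tail_reach_below: "m = n + Suc k \<Longrightarrow>
      hit_tail (- int i) m (Suc (Suc k)) = (reach n (i + Suc k) + reach n (i + Suc (Suc k))) / 2"
    and hit_tail_reach_first: "hit_tail (- int i) m 1 = reach m (Suc i)"
\<comment> \<open>The claims are proved together: from level 1 a step leads either to level 2,
  covered by the first claim, or to level 0, covered by the second or third.\<close>
proof (induction m arbitrary: n k i)
  case 0
  { case 1 then show ?case by simp }
  { case 2 then show ?case by simp }
  { case 3 then show ?case by (simp add: hit_tail_eq_0) }
next
  case (Suc m)
  { case 1
    then have m: "m = n + k" by simp
    show ?case
    proof (cases i)
      case [simp]: 0
      show ?thesis
      proof (cases k)
        case 0
        then show ?thesis using m Suc.IH(3)[of 0] by (simp add: hit_tail_Suc)
      next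
        case [simp]: (Suc k')
        show ?thesis using m Suc.IH(1)[of n k' 1] Suc.IH(2)[of n k' 0]
          by (simp add: hit_tail_Suc)
      qed
    next
      case [simp]: (Suc i')
      show ?thesis
      \<comment> \<open>With \<open>n = 0\<close> all \<open>Suc k\<close> steps would have to be
        hits, but a first step from above level 1 is none; both sides vanish.\<close>
      proof (cases n)
        case 0
        then show ?thesis using m by (simp add: hit_tail_Suc hit_tail_eq_0)
      next
        case [simp]: (Suc n')
        show ?thesis using m Suc.IH(1)[of n' k "Suc i"] Suc.IH(1)[of n' k i']
          by (simp add: hit_tail_Suc field_simps)
      qed
    qed
  }
  { case 2
    then have m: "m = n + k" by simp
    show ?case
    \<comment> \<open>With \<open>n = 0\<close> only \<open>Suc k\<close> steps are available for
      \<open>Suc (Suc k)\<close> hits.\<close>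
    proof (cases n)
      case 0
      then show ?thesis using m by (simp add: hit_tail_Suc hit_tail_eq_0)
    next
      case [simp]: (Suc n')
      show ?thesis
      proof (cases i)
        case [simp]: 0
        show ?thesis using m Suc.IH(1)[of n' k 0] Suc.IH(2)[of n' k 1]
          by (simp add: hit_tail_Suc field_simps)
      next
        case [simp]: (Suc i')
        show ?thesis using m Suc.IH(2)[of n' k i'] Suc.IH(2)[of n' k "Suc i"]
          by (simp add: hit_tail_Suc field_simps)
      qed
    qed
  }
  { case (3 i)
    show ?case
    proof (cases i)
      case 0
      then show ?thesis using Suc.IH(3)[of 1] by (simp add: hit_tail_Suc)
    next
      case [simp]: (Suc i')
      show ?thesis using Suc.IH(3)[of i'] Suc.IH(3)[of "Suc i"] by (simp add: hit_tail_Suc)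
    qed
  }
qed

text \<open>The outer terms are the tails of the return count at \<open>k + 1\<close> and at
  \<open>k\<close>, for \<open>m\<close> rounded down and up to an even length. For positive
  \<open>k\<close> the hit tail averages the passage probabilities to \<open>k\<close> and
  \<open>k + 1\<close>, so it lies between them; monotonicity in time absorbs the rounding.\<close>

lemma hit_tail_bounds:
  shows hit_tail_ge: "reach (2 * (m div 2) - Suc k) (Suc k) \<le> hit_tail 0 m (Suc k)"
    and hit_tail_le: "hit_tail 0 m (Suc k) \<le> reach (2 * ((m + 1) div 2) - k) k"
proof -
  have "reach (2 * (m div 2) - Suc k) (Suc k) \<le> hit_tail 0 m (Suc k) \<and>
    hit_tail 0 m (Suc k) \<le> reach (2 * ((m + 1) div 2) - k) k"
  proof (cases k)
    case [simp]: 0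
    have "hit_tail 0 m 1 = reach m 1" using hit_tail_reach_first[of 0 m] by simp
    then show ?thesis using reach_mono[of "2 * (m div 2) - 1" m 1] reach_le_1[of m 1] by simp
  next
    case [simp]: (Suc k')
    show ?thesis
    proof (cases "m < Suc k'")
      case True
      then show ?thesis by (simp add: hit_tail_eq_0 reach_eq_0 reach_nonneg)
    next
      case False
      define n where "n = m - Suc k'"
      have m: "m = n + Suc k'" using False unfolding n_def by simp
      have eq: "hit_tail 0 m (Suc k) = (reach n (Suc k') + reach n (Suc (Suc k'))) / 2"
        using hit_tail_reach_below[OF m, of 0] by simp
      have "reach (2 * (m div 2) - Suc k) (Suc k) \<le> reach n (Suc k)"
        by (rule reach_mono) (use m in simp)
      moreover have "reach n k \<le> reach (2 * ((m + 1) div 2) - k) k"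
        by (rule reach_mono) (use m in simp)
      ultimately show ?thesis unfolding eq using reach_antimono_Suc[of n k] by simp
    qed
  qed
  then show "reach (2 * (m div 2) - Suc k) (Suc k) \<le> hit_tail 0 m (Suc k)"
    "hit_tail 0 m (Suc k) \<le> reach (2 * ((m + 1) div 2) - k) k" by auto
qed

lemma bit_mean_hits_eq_tail_sum:
  "bit_mean m (\<lambda>bs. f (hits w bs)) = f 0 + (\<Sum>k<m. (f (Suc k) - f k) * hit_tail w m (Suc k))"
proof -
  have eq: "f h = f 0 + (\<Sum>k<m. (f (Suc k) - f k) * of_bool (Suc k \<le> h))" if "h \<le> m" for h
  proof -
    have "(\<Sum>k<m. (f (Suc k) - f k) * of_bool (Suc k \<le> h)) = (\<Sum>k<h. f (Suc k) - f k)"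
      using that by (intro sum.mono_neutral_cong_right) auto
    then show ?thesis by (simp add: sum_lessThan_telescope)
  qed
  have "bit_mean m (\<lambda>bs. f (hits w bs))
      = bit_mean m (\<lambda>bs. f 0 + (\<Sum>k<m. (f (Suc k) - f k) * of_bool (Suc k \<le> hits w bs)))"
    using hits_le_length by (intro bit_mean_cong eq) metis
  then show ?thesis
    unfolding bit_mean_add bit_mean_sum bit_mean_cmult hit_tail_def by simp
qed

section \<open>Comparison of hits with returns\<close>

text \<open>In the tail sums the increments of \<open>f\<close> are nonnegative, so the termwise
  tail bounds carry over to the means. This is stochastic domination.\<close>

lemma
  assumes "mono f"
  shows bit_mean_hits_ge: "ret_mean (m div 2) f \<le> bit_mean m (\<lambda>bs. f (hits 0 bs))"
    and bit_mean_hits_le: "bit_mean m (\<lambda>bs. f (hits 0 bs)) \<le> ret_mean ((m + 1) div 2) (\<lambda>k. f (Suc k))"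
proof -
  have inc: "0 \<le> f (Suc k) - f k" for k using assms by (simp add: mono_iff_le_Suc)
  show "ret_mean (m div 2) f \<le> bit_mean m (\<lambda>bs. f (hits 0 bs))"
    unfolding bit_mean_hits_eq_tail_sum ret_mean_eq_tail_sum[of "m div 2" m, simplified]
    by (intro add_left_mono sum_mono mult_left_mono hit_tail_ge inc)
  let ?M = "(m + 1) div 2"
  have "bit_mean m (\<lambda>bs. f (hits 0 bs)) \<le> f 0 + (\<Sum>k<m. (f (Suc k) - f k) * reach (2 * ?M - k) k)"
    unfolding bit_mean_hits_eq_tail_sum
    by (intro add_left_mono sum_mono mult_left_mono hit_tail_le inc)
  \<comment> \<open>The added term \<open>k = m\<close> is nonnegative. Splitting off the term
    \<open>k = 0\<close>, which turns \<open>f 0\<close> into \<open>f 1\<close>, then leaves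
    exactly \<open>m\<close> shifted terms.\<close>
  also have "\<dots> \<le> f 0 + (\<Sum>k<Suc m. (f (Suc k) - f k) * reach (2 * ?M - k) k)"
    using inc[of m] reach_nonneg[of "2 * ?M - m" m] by simp
  also have "\<dots> = ret_mean ?M (\<lambda>k. f (Suc k))"
    using ret_mean_eq_tail_sum[of ?M m "\<lambda>k. f (Suc k)"]
    by (subst sum.lessThan_Suc_shift) simp
  finally show "bit_mean m (\<lambda>bs. f (hits 0 bs)) \<le> ret_mean ?M (\<lambda>k. f (Suc k))" .
qed

section \<open>Asymptotics of the moments\<close>

definition half_normal_moment :: "nat \<Rightarrow> real" where
  "half_normal_moment r = Gamma ((real r + 1) / 2) / sqrt pi"

text \<open>Legendre's duplication formula at \<open>(r + 1) / 2\<close>, here by induction on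
  \<open>r\<close>. This form matches the limit of the rising factorial moments.\<close>

lemma half_normal_moment_altdef:
  "half_normal_moment r = fact r / (2 ^ r * Gamma (real r / 2 + 1))"
proof -
  have "Gamma ((real r + 1) / 2) * Gamma (real r / 2 + 1) = sqrt pi * fact r / 2 ^ r"
  proof (induction r)
    case 0
    then show ?case by (simp add: Gamma_one_half_real)
  next
    case (Suc r)
    have "Gamma ((real r + 1) / 2 + 1) = (real r + 1) / 2 * Gamma ((real r + 1) / 2)"
      by (rule Gamma_plus1) (auto simp: nonpos_Ints_def)
    moreover have "(real (Suc r) + 1) / 2 = real r / 2 + 1" "real (Suc r) / 2 + 1 = (real r + 1) / 2 + 1"
      by (simp_all add: field_simps)
    ultimately have "Gamma ((real (Suc r) + 1) / 2) * Gamma (real (Suc r) / 2 + 1)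
        = (real r + 1) / 2 * (Gamma ((real r + 1) / 2) * Gamma (real r / 2 + 1))"
      by (simp only: mult_ac)
    then show ?case unfolding Suc.IH by (simp add: field_simps)
  qed
  moreover have "Gamma (real r / 2 + 1) \<noteq> 0" using Gamma_real_pos[of "real r / 2 + 1"] by linarith
  ultimately show ?thesis
    unfolding half_normal_moment_def by (auto simp: divide_simps mult_ac)
qed

lemma ret_mean_pochhammer_asymp:
  "(\<lambda>n. ret_mean n (\<lambda>k. pochhammer (real k + 1) r) / sqrt (real n) ^ r)
     \<longlonglongrightarrow> 2 ^ r * half_normal_moment r"
proof -
  let ?z = "real r / 2"
  have zne: "Gamma (?z + 1) \<noteq> 0" using Gamma_real_pos[of "?z + 1"] by linarith
  have pochpos: "pochhammer (?z + 1) n > 0" for n by (intro pochhammer_pos) simp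
  \<comment> \<open>Euler's limit for \<open>Gamma (?z + 1)\<close> involves a rising factorial with
    \<open>n + 1\<close> factors, while the closed form of the mean has \<open>n\<close>. The
    quotient \<open>real n / (?z + 1 + real n)\<close> makes up for the last factor.\<close>
  have "(\<lambda>n. fact r / Gamma_series (?z + 1) n * (real n / (?z + 1 + real n)))
      \<longlonglongrightarrow> fact r / Gamma (?z + 1) * 1"
  proof (intro tendsto_intros)
    show "(\<lambda>n. real n / (?z + 1 + real n)) \<longlonglongrightarrow> 1" by real_asymp
  qed (use zne in auto)
  moreover have "\<forall>\<^sub>F n in sequentially. fact r / Gamma_series (?z + 1) n * (real n / (?z + 1 + real n))
    = ret_mean n (\<lambda>k. pochhammer (real k + 1) r) / sqrt (real n) ^ r"
    using eventually_gt_at_top[of 0]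
  proof eventually_elim
    case (elim n)
    have "exp ((?z + 1) * ln (real n)) = real n powr (?z + 1)"
      using elim by (simp add: powr_def)
    also have "\<dots> = real n * sqrt (real n) ^ r"
      using elim by (simp add: powr_add powr_half_sqrt[symmetric] powr_power powr_powr mult.commute)
    finally have e: "exp ((?z + 1) * ln (real n)) = real n * sqrt (real n) ^ r" .
    have alg: "f / (F * (N * q) / (y * P)) * (N / y) = f * P / F / q"
      if "F > 0" "N > 0" "q > 0" "y > 0" "P > 0" for f F N q y P :: real
      using that by (simp add: field_simps)
    have "Gamma_series (?z + 1) n = fact n * (real n * sqrt (real n) ^ r) /
        ((?z + 1 + real n) * pochhammer (?z + 1) n)"
      using e by (simp add: Gamma_series_def pochhammer_rec')
    then show ?case
      unfolding ret_mean_pochhammer using elim pochpos[of n] by (simp only:) (rule alg, simp_all)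
  qed
  ultimately show ?thesis
    by (simp add: filterlim_cong half_normal_moment_altdef)
qed

lemma ret_mean_add: "ret_mean n (\<lambda>k. f k + g k) = ret_mean n f + ret_mean n g"
  by (simp add: ret_mean_def sum.distrib ring_distribs)

lemma ret_mean_cmult: "ret_mean n (\<lambda>k. c * f k) = c * ret_mean n f"
  by (simp add: ret_mean_def sum_distrib_left mult.assoc)

text \<open>Rising factorials are monic polynomials. Subtracting the right multiple of one lowers
  the degree bound, and the mean of the remainder is smaller by a factor of order
  \<open>1 / sqrt n\<close>.\<close>

lemma ret_mean_poly_asymp:
  assumes "degree p \<le> r"
  shows "(\<lambda>n. ret_mean n (\<lambda>k. poly p (real k)) / sqrt (real n) ^ r)
     \<longlonglongrightarrow> coeff p r * 2 ^ r * half_normal_moment r"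
  using assms
proof (induction r arbitrary: p)
  case 0
  then obtain c where [simp]: "p = [:c:]" by (metis degree_eq_zeroE le_zero_eq)
  have "(\<lambda>n. c * (ret_mean n (\<lambda>k. pochhammer (real k + 1) 0) / sqrt (real n) ^ 0)) \<longlonglongrightarrow> c * (2 ^ 0 * half_normal_moment 0)"
    by (intro tendsto_mult_left ret_mean_pochhammer_asymp)
  also have "(\<lambda>n. c * (ret_mean n (\<lambda>k. pochhammer (real k + 1) 0) / sqrt (real n) ^ 0)) = (\<lambda>n. ret_mean n (\<lambda>k. poly p (real k)) / sqrt (real n) ^ 0)"
    by (simp flip: ret_mean_cmult)
  finally show ?case by simp
next
  case (Suc r)
  define c where "c = coeff p (Suc r)"
  define P :: "real poly" where "P = (\<Prod>i<Suc r. [:1 + real i, 1:])"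
  have polyP: "poly P x = pochhammer (x + 1) (Suc r)" for x
    by (simp add: P_def poly_prod pochhammer_prod atLeast0LessThan algebra_simps del: prod.lessThan_Suc)
  have degP: "degree P = Suc r"
    unfolding P_def by (subst degree_prod_eq_sum_degree) (auto simp del: sum.lessThan_Suc)
  have "lead_coeff P = 1"
    unfolding P_def lead_coeff_prod by simp
  then have coeffP: "coeff P (Suc r) = 1" by (simp add: degP)
  define q where "q = p - smult c P"
  have "degree q \<le> r"
  proof (rule degree_le, intro allI impI)
    fix i assume "i > r"
    then consider "i = Suc r" | "i > Suc r" by linarith
    then show "coeff q i = 0"
      by cases (use Suc.prems degP in \<open>auto simp: q_def c_def coeffP coeff_eq_0\<close>)
  qed
  from Suc.IH[OF this]
  have "(\<lambda>n. ret_mean n (\<lambda>k. poly q (real k)) / sqrt (real n) ^ r * (1 / sqrt (real n)))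
      \<longlonglongrightarrow> coeff q r * 2 ^ r * half_normal_moment r * 0"
    by (intro tendsto_mult) (assumption, real_asymp)
  then have lim0: "(\<lambda>n. ret_mean n (\<lambda>k. poly q (real k)) / sqrt (real n) ^ Suc r) \<longlonglongrightarrow> 0"
    by (simp add: mult.commute)
  have "p = smult c P + q" by (simp add: q_def)
  then have "poly p (real k) = c * pochhammer (real k + 1) (Suc r) + poly q (real k)" for k
    by (metis poly_add poly_smult polyP)
  then have "(\<lambda>n. ret_mean n (\<lambda>k. poly p (real k)) / sqrt (real n) ^ Suc r) =
    (\<lambda>n. c * (ret_mean n (\<lambda>k. pochhammer (real k + 1) (Suc r)) / sqrt (real n) ^ Suc r)
      + ret_mean n (\<lambda>k. poly q (real k)) / sqrt (real n) ^ Suc r)"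
    by (simp add: ret_mean_add ret_mean_cmult add_divide_distrib)
  moreover have "\<dots> \<longlonglongrightarrow> c * (2 ^ Suc r * half_normal_moment (Suc r)) + 0"
    by (intro tendsto_add lim0 tendsto_mult_left ret_mean_pochhammer_asymp)
  ultimately show ?case by (simp add: c_def mult.assoc)
qed

text \<open>Half a deck gives about \<open>n / 2\<close> steps, that is \<open>n / 4\<close> pairs
  of steps. Renormalizing from \<open>sqrt (a n)\<close> to \<open>sqrt n\<close> contributes
  \<open>(1 / 2) ^ r\<close>, which cancels \<open>2 ^ r\<close>. The shift \<open>c\<close> leaves
  the leading coefficient unchanged.\<close>

lemma ret_mean_power_asymp:
  assumes a: "(\<lambda>n. real (a n) / real n) \<longlonglongrightarrow> 1 / 4"
  shows "(\<lambda>n. ret_mean (a n) (\<lambda>k. (real k + c) ^ r) / sqrt (real n) ^ r) \<longlonglongrightarrow> half_normal_moment r"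
proof -
  have ainf: "filterlim a sequentially sequentially"
  proof -
    have "filterlim (\<lambda>n. (real (a n) / real n) * real n) at_top sequentially"
      by (rule filterlim_tendsto_pos_mult_at_top[OF a]) (auto simp: filterlim_real_sequentially)
    moreover have "\<forall>\<^sub>F n in sequentially. (real (a n) / real n) * real n = real (a n)"
      using eventually_gt_at_top[of 0] by eventually_elim simp
    ultimately have "filterlim (\<lambda>n. real (a n)) at_top sequentially"
      by (simp add: filterlim_cong)
    then show ?thesis by (simp add: filterlim_sequentially_iff_filterlim_real)
  qed
  let ?p = "[:c, 1:] ^ r :: real poly"
  have deg: "degree ?p = r" by (simp add: degree_power_eq)
  have "coeff ?p r = lead_coeff ?p" by (simp only: deg)
  also have "\<dots> = 1" by (subst lead_coeff_power) simp
  finally have co: "coeff ?p r = 1" .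
  have "(\<lambda>n. ret_mean n (\<lambda>k. (real k + c) ^ r) / sqrt (real n) ^ r) \<longlonglongrightarrow> 2 ^ r * half_normal_moment r"
    using ret_mean_poly_asymp[of ?p r] co deg by (simp add: poly_power add.commute)
  from filterlim_compose[OF this ainf]
  have "(\<lambda>n. ret_mean (a n) (\<lambda>k. (real k + c) ^ r) / sqrt (real (a n)) ^ r * sqrt (real (a n) / real n) ^ r)
     \<longlonglongrightarrow> 2 ^ r * half_normal_moment r * sqrt (1 / 4) ^ r"
    by (intro tendsto_intros a)
  moreover have "sqrt (1 / 4) = 1 / (2::real)" by (simp add: real_sqrt_divide)
  moreover have "\<forall>\<^sub>F n in sequentially. ret_mean (a n) (\<lambda>k. (real k + c) ^ r) / sqrt (real (a n)) ^ r * sqrt (real (a n) / real n) ^ r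
    = ret_mean (a n) (\<lambda>k. (real k + c) ^ r) / sqrt (real n) ^ r"
    using eventually_compose_filterlim[OF eventually_gt_at_top[of 0] ainf]
    by eventually_elim (simp add: real_sqrt_divide power_divide)
  ultimately show ?thesis by (simp add: filterlim_cong power_divide)
qed

text \<open>The bounds by the return count and by that count plus one differ in the shift,
  \<open>c\<close> against \<open>c + 1\<close>, and in the rounding of \<open>m n\<close>; neither
  affects the limit. Since \<open>c\<close> is nonnegative, the shifted power is monotone.\<close>

lemma bit_mean_hits_power_asymp:
  assumes m: "(\<lambda>n. real (m n) / real n) \<longlonglongrightarrow> 1 / 2" and "c \<ge> 0"
  shows "(\<lambda>n. bit_mean (m n) (\<lambda>bs. (real (hits 0 bs) + c) ^ r) / sqrt (real n) ^ r)
    \<longlonglongrightarrow> half_normal_moment r"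
proof -
  have mono: "mono (\<lambda>k. (real k + c) ^ r)"
    using \<open>c \<ge> 0\<close> by (intro monoI power_mono) auto
  have inv: "(\<lambda>n. 1 / real n) \<longlonglongrightarrow> 0" by real_asymp
  \<comment> \<open>Applied with \<open>b n\<close> equal to \<open>m n div 2\<close> and to
    \<open>(m n + 1) div 2\<close>.\<close>
  have lim: "(\<lambda>n. real (b n) / real n) \<longlonglongrightarrow> 1 / 4"
    if b: "\<And>n. \<bar>2 * real (b n) - real (m n)\<bar> \<le> 1" for b
  proof (rule tendsto_sandwich)
    show "(\<lambda>n. (real (m n) / real n - 1 / real n) / 2) \<longlonglongrightarrow> 1 / 4"
      using tendsto_divide[OF tendsto_diff[OF m inv] tendsto_const[of 2]] by simp
    show "(\<lambda>n. (real (m n) / real n + 1 / real n) / 2) \<longlonglongrightarrow> 1 / 4"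
      using tendsto_divide[OF tendsto_add[OF m inv] tendsto_const[of 2]] by simp
    show "\<forall>\<^sub>F n in sequentially. (real (m n) / real n - 1 / real n) / 2 \<le> real (b n) / real n"
    proof (intro always_eventually allI)
      fix n
      have "(real (m n) - 1) / 2 / real n \<le> real (b n) / real n"
        using b[of n] by (intro divide_right_mono) (auto simp: abs_le_iff)
      then show "(real (m n) / real n - 1 / real n) / 2 \<le> real (b n) / real n"
        by (simp add: diff_divide_distrib mult.commute)
    qed
    show "\<forall>\<^sub>F n in sequentially. real (b n) / real n \<le> (real (m n) / real n + 1 / real n) / 2"
    proof (intro always_eventually allI)
      fix n
      have "real (b n) / real n \<le> (real (m n) + 1) / 2 / real n"
        using b[of n] by (intro divide_right_mono) (auto simp: abs_le_iff)
      then show "real (b n) / real n \<le> (real (m n) / real n + 1 / real n) / 2"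
        by (simp add: add_divide_distrib mult.commute)
    qed
  qed
  show ?thesis
  proof (rule tendsto_sandwich)
    show "(\<lambda>n. ret_mean (m n div 2) (\<lambda>k. (real k + c) ^ r) / sqrt (real n) ^ r) \<longlonglongrightarrow> half_normal_moment r"
      by (intro ret_mean_power_asymp lim) linarith
    show "(\<lambda>n. ret_mean ((m n + 1) div 2) (\<lambda>k. (real k + (c + 1)) ^ r) / sqrt (real n) ^ r) \<longlonglongrightarrow> half_normal_moment r"
      by (intro ret_mean_power_asymp lim) linarith
    show "\<forall>\<^sub>F n in sequentially. ret_mean (m n div 2) (\<lambda>k. (real k + c) ^ r) / sqrt (real n) ^ r
      \<le> bit_mean (m n) (\<lambda>bs. (real (hits 0 bs) + c) ^ r) / sqrt (real n) ^ r"
      by (intro always_eventually allI divide_right_mono bit_mean_hits_ge[OF mono]) simp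
    show "\<forall>\<^sub>F n in sequentially. bit_mean (m n) (\<lambda>bs. (real (hits 0 bs) + c) ^ r) / sqrt (real n) ^ r
      \<le> ret_mean ((m n + 1) div 2) (\<lambda>k. (real k + (c + 1)) ^ r) / sqrt (real n) ^ r"
      using bit_mean_hits_le[OF mono]
      by (intro always_eventually allI divide_right_mono) (simp_all add: add_ac)
  qed
qed

section \<open>Half-normal moments\<close>

lemma
  assumes D: "distributed M lborel H (\<lambda>x. ennreal (half_normal_density x))"
  shows integrable_half_normal_power: "integrable M (\<lambda>\<omega>. H \<omega> ^ r)"
    and integral_half_normal_power: "(LINT \<omega>|M. H \<omega> ^ r) = half_normal_moment r"
proof -
  have "has_bochner_integral lborel (\<lambda>x. indicator {0..} x *\<^sub>R (exp (-x\<^sup>2) * x ^ r)) (sqrt pi / 2 * half_normal_moment r)"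
  \<comment> \<open>For even \<open>r\<close> the Gamma value in
    \<open>half_normal_moment_altdef\<close> is a factorial, for odd \<open>r\<close> the one in the
    definition is. Each form matches one of the half-line Gaussian moment formulas.\<close>
  proof (cases "even r")
    case True
    then obtain q where [simp]: "r = 2 * q" by (rule evenE)
    have "Gamma (real q + 1) = fact q" by (simp add: Gamma_fact add.commute)
    then have "half_normal_moment r = fact (2 * q) / (2 ^ (2 * q) * fact q)"
      unfolding half_normal_moment_altdef by simp
    then show ?thesis using gaussian_moment_even_pos[of q] by simp
  next
    case False
    then obtain q where [simp]: "r = 2 * q + 1" by (rule oddE)
    have "Gamma (real q + 1) = fact q" by (simp add: Gamma_fact add.commute)
    moreover have "(real r + 1) / 2 = real q + 1" by simp
    ultimately have "half_normal_moment r = fact q / sqrt pi"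
      unfolding half_normal_moment_def by metis
    then show ?thesis using gaussian_moment_odd_pos[of q] by simp
  qed
  then have "has_bochner_integral lborel (\<lambda>x. 2 / sqrt pi * (indicator {0..} x *\<^sub>R (exp (-x\<^sup>2) * x ^ r)))
      (2 / sqrt pi * (sqrt pi / 2 * half_normal_moment r))"
    by (rule has_bochner_integral_mult_right)
  also have "(\<lambda>x. 2 / sqrt pi * (indicator {0..} x *\<^sub>R (exp (-x\<^sup>2) * x ^ r))) = (\<lambda>x. half_normal_density x * x ^ r)"
    by (auto simp: half_normal_density_def indicator_def)
  also have "2 / sqrt pi * (sqrt pi / 2 * half_normal_moment r) = half_normal_moment r"
    by simp
  finally have I: "has_bochner_integral lborel (\<lambda>x. half_normal_density x * x ^ r) (half_normal_moment r)" .
  have nn: "0 \<le> half_normal_density x" for x by (simp add: half_normal_density_def)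
  show "integrable M (\<lambda>\<omega>. H \<omega> ^ r)"
    using distributed_integrable[OF D, of "\<lambda>x. x ^ r"] I nn by (auto simp: has_bochner_integral_iff)
  show "(LINT \<omega>|M. H \<omega> ^ r) = half_normal_moment r"
    using distributed_integral[OF D, of "\<lambda>x. x ^ r"] I nn by (auto simp: has_bochner_integral_iff)
qed

lemma integral_sum_half_normal_power:
  assumes M: "prob_space M"
    and D1: "distributed M lborel H1 (\<lambda>x. ennreal (half_normal_density x))"
    and D2: "distributed M lborel H2 (\<lambda>x. ennreal (half_normal_density x))"
    and ind: "prob_space.indep_var M borel H1 borel H2"
  shows "(LINT \<omega>|M. (H1 \<omega> + H2 \<omega>) ^ s) =
    (\<Sum>k\<le>s. real (s choose k) * (half_normal_moment k * half_normal_moment (s - k)))"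
proof -
  interpret prob_space M by (rule M)
  have ind': "indep_var borel (\<lambda>\<omega>. H1 \<omega> ^ i) borel (\<lambda>\<omega>. H2 \<omega> ^ j)" for i j
    using indep_var_compose[OF ind, of "\<lambda>x. x ^ i" borel "\<lambda>x. x ^ j" borel] by (simp add: comp_def)
  note int1 = integrable_half_normal_power[OF D1] and int2 = integrable_half_normal_power[OF D2]
  have int: "integrable M (\<lambda>\<omega>. H1 \<omega> ^ i * H2 \<omega> ^ j)" for i j
    by (rule indep_var_integrable[OF ind' int1 int2])
  have "(LINT \<omega>|M. (H1 \<omega> + H2 \<omega>) ^ s)
      = (LINT \<omega>|M. (\<Sum>k\<le>s. real (s choose k) * (H1 \<omega> ^ k * H2 \<omega> ^ (s - k))))"
    by (simp add: binomial_ring mult.assoc)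
  also have "\<dots> = (\<Sum>k\<le>s. real (s choose k) * (LINT \<omega>|M. H1 \<omega> ^ k * H2 \<omega> ^ (s - k)))"
    using int by (subst Bochner_Integration.integral_sum) auto
  also have "\<dots> = (\<Sum>k\<le>s. real (s choose k) * (half_normal_moment k * half_normal_moment (s - k)))"
    using indep_var_lebesgue_integral[OF ind' int1 int2]
    by (simp add: integral_half_normal_power[OF D1] integral_half_normal_power[OF D2])
  finally show ?thesis .
qed

section \<open>Riffle shuffles as bit sequences\<close>

abbreviation trues :: "bool list \<Rightarrow> nat" where
  "trues bs \<equiv> length (filter id bs)"

abbreviation falses :: "bool list \<Rightarrow> nat" where
  "falses bs \<equiv> length (filter Not bs)"

lemma trues_plus_falses: "trues bs + falses bs = length bs"
  by (induction bs) auto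

lemma length_filter_split_at:
  assumes "i < length xs"
  shows "length (filter P xs) =
    length (filter P (take i xs)) + of_bool (P (xs ! i)) + length (filter P (drop (Suc i) xs))"
proof -
  have "filter P xs = filter P (take i xs @ xs ! i # drop (Suc i) xs)"
    using id_take_nth_drop[OF assms] by simp
  then show ?thesis by simp
qed

lemma nth_eq_nth_filter:
  assumes "i < length xs" "P (xs ! i)"
  shows "xs ! i = filter P xs ! length (filter P (take i xs))"
proof -
  have "filter P xs = filter P (take i xs @ xs ! i # drop (Suc i) xs)"
    using id_take_nth_drop[OF assms(1)] by simp
  then show ?thesis using assms(2) by (simp add: nth_append)
qed

text \<open>The deck in which position \<open>i\<close> (counted from 0) is dealt from the first packet iff \<open>bs ! i\<close>.\<close>

definition deck :: "bool list \<Rightarrow> nat list" where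
  "deck bs = map (\<lambda>i. if bs ! i then trues (take i bs) + 1 else trues bs + falses (take i bs) + 1)
     [0..<length bs]"

text \<open>Filtering a shuffle by packet returns that packet in order. A label is therefore
  determined by the card's rank within its packet, which is what \<open>deck\<close> computes from
  the bits.\<close>

lemma shuffle_eq_deck:
  assumes "k \<le> n" and d: "d \<in> shuffles [1..<k + 1] [k + 1..<n + 1]"
  shows "trues (map (\<lambda>c. c \<le> k) d) = k" and "deck (map (\<lambda>c. c \<le> k) d) = d"
proof -
  let ?bs = "map (\<lambda>c. c \<le> k) d"
  have disj: "set [1..<k + 1] \<inter> set [k + 1..<n + 1] = {}" by auto
  have setd: "set d = {1..n}"
    unfolding set_shuffles[OF d] set_upt using \<open>k \<le> n\<close> by auto
  have "filter (\<lambda>c. c \<le> k) d = filter (\<lambda>c. c \<in> set [1..<k + 1]) d"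
    by (rule filter_cong) (use setd in auto)
  then have f1: "filter (\<lambda>c. c \<le> k) d = [1..<k + 1]"
    using filter_shuffles_disjoint1(1)[OF disj d] by metis
  have "filter (\<lambda>c. \<not> c \<le> k) d = filter (\<lambda>c. c \<notin> set [1..<k + 1]) d"
    by (rule filter_cong) (use setd in auto)
  then have f2: "filter (\<lambda>c. \<not> c \<le> k) d = [k + 1..<n + 1]"
    using filter_shuffles_disjoint1(2)[OF disj d] by metis
  have tr: "trues (map (\<lambda>c. c \<le> k) xs) = length (filter (\<lambda>c. c \<le> k) xs)" for xs
    by (simp add: length_filter_map comp_def)
  have fa: "falses (map (\<lambda>c. c \<le> k) xs) = length (filter (\<lambda>c. \<not> c \<le> k) xs)" for xs
    by (simp add: length_filter_map comp_def)
  show k: "trues ?bs = k" unfolding tr f1 by simp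
  show "deck ?bs = d"
  proof (rule nth_equalityI)
    fix i assume "i < length (deck ?bs)"
    then have i: "i < length d" by (simp add: deck_def)
    show "deck ?bs ! i = d ! i"
    proof (cases "d ! i \<le> k")
      case True
      have "length (filter (\<lambda>c. c \<le> k) (take i d)) < length (filter (\<lambda>c. c \<le> k) d)"
        using length_filter_split_at[OF i, of "\<lambda>c. c \<le> k"] True by simp
      then have "1 + length (filter (\<lambda>c. c \<le> k) (take i d)) < k + 1"
        unfolding f1 length_upt by simp
      from nth_upt[OF this]
      have "d ! i = length (filter (\<lambda>c. c \<le> k) (take i d)) + 1"
        using nth_eq_nth_filter[of i d "\<lambda>c. c \<le> k", OF i True] unfolding f1 by (simp only: add.commute)
      then show ?thesis using i True by (simp add: deck_def take_map tr del: filter_map)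
    next
      case False
      have "length (filter (\<lambda>c. \<not> c \<le> k) (take i d)) < length (filter (\<lambda>c. \<not> c \<le> k) d)"
        using length_filter_split_at[OF i, of "\<lambda>c. \<not> c \<le> k"] False by simp
      then have "k + 1 + length (filter (\<lambda>c. \<not> c \<le> k) (take i d)) < n + 1"
        unfolding f2 length_upt using \<open>k \<le> n\<close> by simp
      from nth_upt[OF this]
      have "d ! i = k + length (filter (\<lambda>c. \<not> c \<le> k) (take i d)) + 1"
        using nth_eq_nth_filter[of i d "\<lambda>c. \<not> c \<le> k", OF i False] unfolding f2 by (simp only: add_ac)
      then show ?thesis using i False k by (simp add: deck_def take_map comp_def length_filter_map)
    qed
  qed (simp add: deck_def)
qed

text \<open>The cut has weight \<open>(n choose k) / 2 ^ n\<close> and each interleaving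
  \<open>1 / (n choose k)\<close>, so every pair of cut and interleaving weighs
  \<open>1 / 2 ^ n\<close>. Such pairs, rather than decks, are matched with bit strings, since
  different cuts can produce the same deck.\<close>

lemma expectation_gsr_shuffle:
  "measure_pmf.expectation (gsr_shuffle n) f = bit_mean n (\<lambda>bs. f (deck bs))"
proof -
  define S where "S k = shuffles [1..<k + 1] [k + 1..<n + 1]" for k
  let ?bits = "\<lambda>(k, d). map (\<lambda>c. c \<le> k) d :: bool list"
  have ne: "S k \<noteq> {}" for k unfolding S_def using splice_in_shuffles by blast
  have fin: "finite (S k)" for k by (simp add: S_def del: upt_Suc)
  have card: "card (S k) = n choose k" if "k \<le> n" for k
  proof -
    have "card (S k) = length [1..<k + 1] + length [k + 1..<n + 1] choose length [1..<k + 1]"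
      unfolding S_def by (rule card_disjoint_shuffles) auto
    then show ?thesis using that unfolding length_upt by simp
  qed
  have bits: "trues (?bits x) = fst x" "deck (?bits x) = snd x" "length (?bits x) = n"
    if "x \<in> Sigma {..n} S" for x
    using that shuffle_eq_deck[of "fst x" n "snd x"] length_shuffles[of "snd x"]
    by (auto simp: S_def split_beta simp del: upt_Suc)
  have inj: "inj_on ?bits (Sigma {..n} S)"
    by (rule inj_on_inverseI[of _ "\<lambda>bs. (trues bs, deck bs)"]) (simp only: bits prod.collapse)
  have sub: "?bits ` Sigma {..n} S \<subseteq> {bs. length bs = n}"
    using bits(3) by blast
  \<comment> \<open>Surjectivity follows by counting: a row of Pascal's triangle sums to
    \<open>2 ^ n\<close>.\<close>
  have "card (Sigma {..n} S) = (\<Sum>k\<le>n. n choose k)"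
    by (simp add: card fin)
  also have "\<dots> = card {bs :: bool list. length bs = n}"
    unfolding card_bit_lists by (rule choose_row_sum)
  finally have "bij_betw ?bits (Sigma {..n} S) {bs. length bs = n}"
    unfolding bij_betw_def using inj sub
    by (metis card_image card_subset_eq finite_bit_lists)
  then have "(\<Sum>bs | length bs = n. f (deck bs)) = (\<Sum>x\<in>Sigma {..n} S. f (deck (?bits x)))"
    by (rule sum.reindex_bij_betw[symmetric])
  also have "\<dots> = (\<Sum>x\<in>Sigma {..n} S. f (snd x))"
    by (intro sum.cong refl) (simp only: bits)
  also have "\<dots> = (\<Sum>k\<le>n. \<Sum>d\<in>S k. f d)"
    by (subst sum.Sigma) (auto simp: case_prod_unfold fin)
  finally have sum: "(\<Sum>bs | length bs = n. f (deck bs)) = (\<Sum>k\<le>n. \<Sum>d\<in>S k. f d)" .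
  have "measure_pmf.expectation (gsr_shuffle n) f
      = (\<Sum>k\<le>n. pmf (binomial_pmf n (1 / 2)) k *\<^sub>R measure_pmf.expectation (pmf_of_set (S k)) f)"
    unfolding gsr_shuffle_def S_def[symmetric]
    by (intro pmf_expectation_bind) (auto simp: set_pmf_of_set[OF ne fin] fin)
  also have "\<dots> = (\<Sum>k\<le>n. (\<Sum>d\<in>S k. f d) / 2 ^ n)"
  proof (intro sum.cong refl)
    fix k assume "k \<in> {..n}"
    then have k: "k \<le> n" by simp
    have "pmf (binomial_pmf n (1 / 2)) k = real (n choose k) / 2 ^ n"
      using k by (simp add: power_divide power_add[symmetric])
    moreover have "measure_pmf.expectation (pmf_of_set (S k)) f = (\<Sum>d\<in>S k. f d) / real (n choose k)"
      using card[OF k] by (subst integral_pmf_of_set[OF ne fin]) simp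
    ultimately show "pmf (binomial_pmf n (1 / 2)) k *\<^sub>R measure_pmf.expectation (pmf_of_set (S k)) f
        = (\<Sum>d\<in>S k. f d) / 2 ^ n"
      using k by simp
  qed
  finally show ?thesis by (simp add: bit_mean_def sum sum_divide_distrib)
qed

section \<open>Correct guesses as hits\<close>

lemma hits_eq_card_walk:
  "hits w bs = card {i. i < length bs \<and> bs ! i \<and> w + 2 * int (trues (take i bs)) - int i \<in> {0, 1}}"
proof (induction bs arbitrary: w)
  case (Cons b bs)
  let ?w = "if b then w + 1 else w - 1"
  define A where
    "A = {i. i < length bs \<and> bs ! i \<and> ?w + 2 * int (trues (take i bs)) - int i \<in> {0, 1}}"
  define B where
    "B = {i. i < length (b # bs) \<and> (b # bs) ! i \<and> w + 2 * int (trues (take i (b # bs))) - int i \<in> {0, 1}}"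
  define Z :: "nat set" where "Z = (if b \<and> w \<in> {0, 1} then {0} else {})"
  have "Suc i \<in> B \<longleftrightarrow> i \<in> A" for i
  proof -
    have "w + 2 * int (trues (take (Suc i) (b # bs))) - int (Suc i) = ?w + 2 * int (trues (take i bs)) - int i"
      by (cases b) simp_all
    then show ?thesis unfolding A_def B_def mem_Collect_eq by (simp only: length_Cons nth_Cons_Suc Suc_less_eq)
  qed
  moreover have "0 \<in> B \<longleftrightarrow> 0 \<in> Z" by (auto simp: B_def Z_def)
  moreover have "Suc i \<notin> Z" for i by (simp add: Z_def)
  ultimately have "B = Z \<union> Suc ` A"
    by (intro set_eqI) (metis UnCI UnE imageE imageI nat.exhaust nat.distinct(1) nat.inject)
  moreover have "finite A" "finite Z" "Z \<inter> Suc ` A = {}" "card Z = of_bool (b \<and> w \<in> {0, 1})"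
    by (auto simp: A_def Z_def)
  ultimately have "card B = of_bool (b \<and> w \<in> {0, 1}) + card A"
    by (simp add: card_Un_disjoint card_image)
  then show ?case unfolding hits.simps Cons.IH A_def B_def by (rule sym)
qed simp

text \<open>Being at level 0 or 1 after \<open>i\<close> steps means that
  \<open>(i + 1) div 2\<close> cards came from the first packet. The next card of that packet then
  carries the label \<open>(i + 1) div 2 + 1\<close>, the guess for the top half.\<close>

lemma hits_0_eq_card:
  "hits 0 bs = card {i. i < length bs \<and> bs ! i \<and> trues (take i bs) = (i + 1) div 2}"
proof -
  have "0 + 2 * int t - int i \<in> {0, 1} \<longleftrightarrow> t = (i + 1) div 2" for t i by auto
  then show ?thesis unfolding hits_eq_card_walk by presburger
qed

lemma deck_nth:
  "i < length bs \<Longrightarrow>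
    deck bs ! i = (if bs ! i then trues (take i bs) + 1 else trues bs + falses (take i bs) + 1)"
  by (simp add: deck_def)

lemma deck_eq_guess_top:
  assumes len: "length bs = n" and i: "i < (n + 1) div 2"
  shows "bs ! i \<and> trues (take i bs) = (i + 1) div 2 \<Longrightarrow> deck bs ! i = guess n (Suc i)"
    and "deck bs ! i = guess n (Suc i) \<Longrightarrow> bs ! i \<and> trues (take i bs) = (i + 1) div 2 \<or> i \<le> 1"
proof -
  have h: "nat \<lceil>real n / 2\<rceil> = (n + 1) div 2" by linarith
  have g: "guess n (Suc i) = (i + 1) div 2 + 1" using i by (simp add: guess_def h)
  have "i < n" using i by simp
  then have il: "i < length bs" using len by simp
  show "bs ! i \<and> trues (take i bs) = (i + 1) div 2 \<Longrightarrow> deck bs ! i = guess n (Suc i)"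
    unfolding g deck_nth[OF il] by simp
  assume eq: "deck bs ! i = guess n (Suc i)"
  show "bs ! i \<and> trues (take i bs) = (i + 1) div 2 \<or> i \<le> 1"
  proof (cases "bs ! i")
    case True
    then show ?thesis using eq unfolding g deck_nth[OF il] by simp
  next
    case False
    \<comment> \<open>A second-packet card at this place has label at least \<open>i + 1\<close>,
      which exceeds the guess \<open>(i + 1) div 2 + 1\<close> once \<open>i\<close> is at least
      2.\<close>
    have "i \<le> trues bs + falses (take i bs)"
      using trues_plus_falses[of "take i bs"] length_filter_split_at[OF il, of id] il by simp
    then show ?thesis using eq False unfolding g deck_nth[OF il] by simp
  qed
qed

text \<open>Mirror image of the top half, with \<open>i\<close> counted from 0 at the bottom: a
  second-packet card has label \<open>n\<close> minus the number of second-packet cards below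
  it.\<close>

lemma deck_eq_guess_bottom:
  assumes len: "length bs = n" and i: "i < n - (n + 1) div 2"
  shows "\<not> bs ! (n - Suc i) \<and> falses (drop (n - i) bs) = (i + 1) div 2 \<Longrightarrow>
      deck bs ! (n - Suc i) = guess n (n - i)"
    and "deck bs ! (n - Suc i) = guess n (n - i) \<Longrightarrow>
      \<not> bs ! (n - Suc i) \<and> falses (drop (n - i) bs) = (i + 1) div 2 \<or> i \<le> 1"
proof -
  have h: "nat \<lceil>real n / 2\<rceil> = (n + 1) div 2" by linarith
  have g: "guess n (n - i) = n - (i + 1) div 2" using i by (auto simp: guess_def h)
  have il: "n - Suc i < length bs" and Suc: "Suc (n - Suc i) = n - i" using i len by auto
  have low: "deck bs ! (n - Suc i) = n - falses (drop (n - i) bs)" if "\<not> bs ! (n - Suc i)"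
    using that trues_plus_falses[of bs] length_filter_split_at[OF il, of Not] len
    unfolding deck_nth[OF il] Suc by simp
  show "\<not> bs ! (n - Suc i) \<and> falses (drop (n - i) bs) = (i + 1) div 2 \<Longrightarrow>
      deck bs ! (n - Suc i) = guess n (n - i)"
    using low unfolding g by simp
  assume eq: "deck bs ! (n - Suc i) = guess n (n - i)"
  show "\<not> bs ! (n - Suc i) \<and> falses (drop (n - i) bs) = (i + 1) div 2 \<or> i \<le> 1"
  proof (cases "bs ! (n - Suc i)")
    case True
    \<comment> \<open>A first-packet card here has label at most \<open>n - i\<close>, which is
      below the guess once \<open>i\<close> is at least 2.\<close>
    have "trues (take (n - Suc i) bs) \<le> n - Suc i"
      using length_filter_le[of id "take (n - Suc i) bs"] by simp
    then show ?thesis using eq True i unfolding g deck_nth[OF il] by simp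
  next
    case False
    have "falses (drop (n - i) bs) \<le> i"
      using length_filter_le[of Not "drop (n - i) bs"] len i by simp
    \<comment> \<open>Both subtrahends are at most \<open>n\<close>, so the truncated differences
      from \<open>n\<close> can be cancelled.\<close>
    moreover have "(i + 1) div 2 \<le> n" using i by simp
    ultimately have "falses (drop (n - i) bs) = (i + 1) div 2"
      using eq i unfolding g low[OF False] by linarith
    then show ?thesis using False by simp
  qed
qed

lemma correct_guesses_bounds:
  assumes len: "length u = (n + 1) div 2" "length v = n - (n + 1) div 2"
  defines "X \<equiv> correct_guesses n (deck (u @ v))" and "Y \<equiv> hits 0 u + hits 0 (rev (map Not v))"
  shows "Y \<le> X" and "X \<le> Y + 4"
proof -
  define h where "h = (n + 1) div 2"
  define bs where "bs = u @ v"
  have hn: "h \<le> n" by (simp add: h_def)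
  have lenbs: "length bs = n" using len hn by (simp add: bs_def h_def)
  define U where "U = {i. i < h \<and> bs ! i \<and> trues (take i bs) = (i + 1) div 2}"
  define V where "V = {i. i < n - h \<and> \<not> bs ! (n - Suc i) \<and> falses (drop (n - i) bs) = (i + 1) div 2}"
  define C where "C = {j \<in> {1..n}. deck bs ! (j - 1) = guess n j}"
  have U: "hits 0 u = card U"
    unfolding hits_0_eq_card U_def using len
    by (intro arg_cong[of _ _ card]) (auto simp: bs_def h_def nth_append)
  \<comment> \<open>Reading the bottom half upwards with the packets exchanged gives a walk started
    at 0, whose hits are the elements of \<open>V\<close>.\<close>
  have "rev (map Not v) ! i = (\<not> bs ! (n - Suc i))" if "i < n - h" for i
  proof -
    have "rev (map Not v) ! i = (\<not> v ! (n - h - Suc i))"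
      using that len by (simp add: rev_nth h_def)
    moreover have "n - Suc i = h + (n - h - Suc i)" using that by simp
    then have "bs ! (n - Suc i) = v ! (n - h - Suc i)"
      using len by (simp add: bs_def nth_append h_def)
    ultimately show ?thesis by simp
  qed
  moreover have "trues (take i (rev (map Not v))) = falses (drop (n - i) bs)" if "i < n - h" for i
  proof -
    have "take i (rev (map Not v)) = rev (map Not (drop (n - i) bs))"
      using that len hn by (simp add: take_rev bs_def h_def drop_map add.commute)
    then show ?thesis by (simp add: rev_filter[symmetric] length_filter_map comp_def)
  qed
  ultimately have V: "hits 0 (rev (map Not v)) = card V"
    unfolding hits_0_eq_card V_def using len
    by (intro arg_cong[of _ _ card]) (auto simp: h_def)
  let ?UV = "Suc ` U \<union> (\<lambda>i. n - i) ` V"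
  have fin: "finite U" "finite V" by (auto simp: U_def V_def)
  have cardUV: "card ?UV = card U + card V"
  proof (subst card_Un_disjoint)
    show "Suc ` U \<inter> (\<lambda>i. n - i) ` V = {}" by (auto simp: U_def V_def)
    have "inj_on (\<lambda>i. n - i) V" by (auto simp: inj_on_def V_def)
    then show "card (Suc ` U) + card ((\<lambda>i. n - i) ` V) = card U + card V"
      by (simp add: card_image)
  qed (use fin in auto)
  have X: "X = card C" by (simp add: X_def correct_guesses_def C_def bs_def)
  have "?UV \<subseteq> C"
  proof
    fix j assume "j \<in> ?UV"
    then consider i where "i \<in> U" "j = Suc i" | i where "i \<in> V" "j = n - i" by auto
    then show "j \<in> C"
    proof cases
      case (1 i)
      then show ?thesis
        using deck_eq_guess_top(1)[OF lenbs, of i] hn by (auto simp: U_def C_def h_def)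
    next
      case (2 i)
      then show ?thesis
        using deck_eq_guess_bottom(1)[OF lenbs, of i] hn by (auto simp: V_def C_def h_def)
    qed
  qed
  moreover have "finite C" by (simp add: C_def)
  ultimately show "Y \<le> X"
    unfolding X Y_def U V cardUV[symmetric] by (intro card_mono)
  \<comment> \<open>The exceptions \<open>i <= 1\<close> of the two halves are the positions 1, 2
    and \<open>n\<close>, \<open>n - 1\<close>; they account for the slack of 4.\<close>
  have "C \<subseteq> ?UV \<union> {1, 2, n, n - 1}"
  proof
    fix j assume j: "j \<in> C"
    show "j \<in> ?UV \<union> {1, 2, n, n - 1}"
    proof (cases "j \<le> h")
      case True
      then obtain i where i: "j = Suc i" "i < h" using j by (cases j) (auto simp: C_def)
      then have "i \<in> U \<or> i \<le> 1"
        using deck_eq_guess_top(2)[OF lenbs, of i] j by (auto simp: U_def C_def h_def)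
      then show ?thesis using i by auto
    next
      case False
      then obtain i where i: "j = n - i" "i < n - h" using j
        by (intro that[of "n - j"]) (auto simp: C_def)
      then have "i \<in> V \<or> i \<le> 1"
        using deck_eq_guess_bottom(2)[OF lenbs, of i] j by (auto simp: V_def C_def h_def)
      then show ?thesis using i by (auto simp: le_Suc_eq)
    qed
  qed
  then have "card C \<le> card (?UV \<union> {1, 2, n, n - 1})" using fin by (intro card_mono) auto
  also have "\<dots> \<le> card ?UV + card {1, 2, n, n - 1}" by (rule card_Un_le)
  also have "card {1, 2, n, n - 1} \<le> 4" by (simp add: card_insert_if)
  finally show "X \<le> Y + 4"
    unfolding X Y_def U V cardUV by simp
qed

section \<open>Combination of the two halves\<close>

text \<open>The bits of the two halves are independent, so the mean of each term of the binomial
  expansion factorizes.\<close>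

lemma bit_mean_split_power:
  fixes f g :: "bool list \<Rightarrow> real"
  shows "bit_mean m (\<lambda>u. bit_mean l (\<lambda>v. (f u + g (rev (map Not v))) ^ s)) =
    (\<Sum>k\<le>s. real (s choose k) * (bit_mean m (\<lambda>u. f u ^ k) * bit_mean l (\<lambda>v. g v ^ (s - k))))"
proof -
  have inner: "bit_mean l (\<lambda>v. (f u + g (rev (map Not v))) ^ s)
      = (\<Sum>k\<le>s. real (s choose k) * bit_mean l (\<lambda>v. g v ^ (s - k)) * f u ^ k)" for u
  proof -
    have "bit_mean l (\<lambda>v. (f u + g (rev (map Not v))) ^ s) = bit_mean l (\<lambda>v. (f u + g v) ^ s)"
      by (rule bit_mean_rev_Not)
    then show ?thesis
      unfolding binomial_ring bit_mean_sum bit_mean_cmult by (simp add: mult_ac)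
  qed
  show ?thesis
    unfolding inner bit_mean_sum bit_mean_cmult by (simp add: mult_ac)
qed

lemma bit_mean_split_power_asymp:
  assumes "c \<ge> 0"
  shows "(\<lambda>n. bit_mean ((n + 1) div 2) (\<lambda>u. bit_mean (n - (n + 1) div 2)
            (\<lambda>v. ((real (hits 0 u) + c) + (real (hits 0 (rev (map Not v))) + c)) ^ s)) / sqrt (real n) ^ s)
    \<longlonglongrightarrow> (\<Sum>k\<le>s. real (s choose k) * (half_normal_moment k * half_normal_moment (s - k)))"
proof -
  have h1: "(\<lambda>n. real ((n + 1) div 2) / real n) \<longlonglongrightarrow> 1 / 2" by real_asymp
  have "(\<lambda>n. 1 - real ((n + 1) div 2) / real n) \<longlonglongrightarrow> 1 - 1 / 2"
    by (intro tendsto_intros h1)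
  moreover have "\<forall>\<^sub>F n in sequentially. 1 - real ((n + 1) div 2) / real n = real (n - (n + 1) div 2) / real n"
    using eventually_gt_at_top[of 0] by eventually_elim (simp add: of_nat_diff diff_divide_distrib)
  ultimately have h2: "(\<lambda>n. real (n - (n + 1) div 2) / real n) \<longlonglongrightarrow> 1 / 2"
    by (simp add: filterlim_cong)
  let ?E = "\<lambda>m n k. bit_mean m (\<lambda>bs. (real (hits 0 bs) + c) ^ k) / sqrt (real n) ^ k"
  have "(\<lambda>n. \<Sum>k\<le>s. real (s choose k) * (?E ((n + 1) div 2) n k * ?E (n - (n + 1) div 2) n (s - k)))
    \<longlonglongrightarrow> (\<Sum>k\<le>s. real (s choose k) * (half_normal_moment k * half_normal_moment (s - k)))"
    by (intro tendsto_intros bit_mean_hits_power_asymp[OF h1 assms] bit_mean_hits_power_asymp[OF h2 assms])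
  also have "(\<lambda>n. \<Sum>k\<le>s. real (s choose k) * (?E ((n + 1) div 2) n k * ?E (n - (n + 1) div 2) n (s - k)))
    = (\<lambda>n. bit_mean ((n + 1) div 2) (\<lambda>u. bit_mean (n - (n + 1) div 2)
            (\<lambda>v. ((real (hits 0 u) + c) + (real (hits 0 (rev (map Not v))) + c)) ^ s)) / sqrt (real n) ^ s)"
    unfolding bit_mean_split_power[where f = "\<lambda>bs. real (hits 0 bs) + c" and g = "\<lambda>bs. real (hits 0 bs) + c"] sum_divide_distrib
    by (intro ext sum.cong refl) (simp add: power_add[symmetric])
  finally show ?thesis .
qed

theorem mainTheorem2:
  fixes M :: "'a measure" and H1 H2 :: "'a \<Rightarrow> real" and s :: nat
  assumes "prob_space M"
    and "distributed M lborel H1 (\<lambda>x. ennreal (half_normal_density x))"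
    and "distributed M lborel H2 (\<lambda>x. ennreal (half_normal_density x))"
    and "prob_space.indep_var M borel H1 borel H2"
  shows "((\<lambda>n. measure_pmf.expectation (gsr_shuffle n)
             (\<lambda>d. (real (correct_guesses n d) / sqrt (real n)) ^ s))
           \<longlonglongrightarrow> (LINT \<omega>|M. (H1 \<omega> + H2 \<omega>) ^ s)) \<and>
         (LINT \<omega>|M. (H1 \<omega> + H2 \<omega>) ^ s) =
           (\<Sum>k=0..s. real (s choose k) *
              (Gamma ((real k + 1) / 2) * Gamma ((real s - real k + 1) / 2) / pi))"
proof
  note moment = integral_sum_half_normal_power[OF assms]
  show "(LINT \<omega>|M. (H1 \<omega> + H2 \<omega>) ^ s) =
           (\<Sum>k=0..s. real (s choose k) *
              (Gamma ((real k + 1) / 2) * Gamma ((real s - real k + 1) / 2) / pi))"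
    unfolding moment half_normal_moment_def atLeast0AtMost
    by (intro sum.cong) (auto simp: of_nat_diff)
  have X: "measure_pmf.expectation (gsr_shuffle n) (\<lambda>d. (real (correct_guesses n d) / sqrt (real n)) ^ s)
    = bit_mean ((n + 1) div 2) (\<lambda>u. bit_mean (n - (n + 1) div 2)
        (\<lambda>v. real (correct_guesses n (deck (u @ v))) ^ s)) / sqrt (real n) ^ s" for n
  proof -
    let ?f = "\<lambda>bs. real (correct_guesses n (deck bs)) ^ s"
    have "(n + 1) div 2 + (n - (n + 1) div 2) = n" by simp
    with bit_mean_append[of "(n + 1) div 2" "n - (n + 1) div 2" ?f]
    have "bit_mean n ?f = bit_mean ((n + 1) div 2) (\<lambda>u. bit_mean (n - (n + 1) div 2) (\<lambda>v. ?f (u @ v)))"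
      by (simp only:)
    then show ?thesis
      using bit_mean_cmult[of n "1 / sqrt (real n) ^ s" ?f]
      unfolding expectation_gsr_shuffle power_divide by (simp only: times_divide_eq_left mult_1)
  qed
  show "(\<lambda>n. measure_pmf.expectation (gsr_shuffle n)
             (\<lambda>d. (real (correct_guesses n d) / sqrt (real n)) ^ s))
           \<longlonglongrightarrow> (LINT \<omega>|M. (H1 \<omega> + H2 \<omega>) ^ s)"
    unfolding X moment
  \<comment> \<open>The error of at most 4 is shared as a shift of 2 in each half. The shifts 0 and
    2 lead to the same limit.\<close>
  proof (rule tendsto_sandwich[OF always_eventually always_eventually
      bit_mean_split_power_asymp[of 0] bit_mean_split_power_asymp[of 2]]; (intro allI)?)
    fix n
    show "bit_mean ((n + 1) div 2) (\<lambda>u. bit_mean (n - (n + 1) div 2)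
            (\<lambda>v. ((real (hits 0 u) + 0) + (real (hits 0 (rev (map Not v))) + 0)) ^ s)) / sqrt (real n) ^ s
      \<le> bit_mean ((n + 1) div 2) (\<lambda>u. bit_mean (n - (n + 1) div 2)
        (\<lambda>v. real (correct_guesses n (deck (u @ v))) ^ s)) / sqrt (real n) ^ s"
    proof (intro divide_right_mono bit_mean_mono power_mono)
      fix u v :: "bool list"
      assume "length u = (n + 1) div 2" "length v = n - (n + 1) div 2"
      from correct_guesses_bounds(1)[OF this]
      show "real (hits 0 u) + 0 + (real (hits 0 (rev (map Not v))) + 0)
        \<le> real (correct_guesses n (deck (u @ v)))" by linarith
    qed auto
    show "bit_mean ((n + 1) div 2) (\<lambda>u. bit_mean (n - (n + 1) div 2)
        (\<lambda>v. real (correct_guesses n (deck (u @ v))) ^ s)) / sqrt (real n) ^ s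
      \<le> bit_mean ((n + 1) div 2) (\<lambda>u. bit_mean (n - (n + 1) div 2)
            (\<lambda>v. ((real (hits 0 u) + 2) + (real (hits 0 (rev (map Not v))) + 2)) ^ s)) / sqrt (real n) ^ s"
    proof (intro divide_right_mono bit_mean_mono power_mono)
      fix u v :: "bool list"
      assume "length u = (n + 1) div 2" "length v = n - (n + 1) div 2"
      from correct_guesses_bounds(2)[OF this]
      show "real (correct_guesses n (deck (u @ v)))
        \<le> real (hits 0 u) + 2 + (real (hits 0 (rev (map Not v))) + 2)" by linarith
    qed auto
  qed auto
qed

end
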